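(* Let $E_0=(A,\mathcal{R})$ be the semi-Thue system with alphabet $A=\{0,\bar 0,L,R,W\}$ and rewriting rules $$R0\to\bar 0R,\qquad \bar 0L\to L0,\qquad WL\to WR,\qquad LWW\to R0W,$$ and let $E=\langle\langle A\mid\mathcal{R}\rangle\rangle$ be the semigroup with generators $A$ and defining relations obtained by symmetrizing these rules. Then the derivational complexity of $E_0$ satisfies $\Delta_{E_0}(n)\in\Theta(n)$, while the Dehn function of $E$ satisfies $D_E(n)\succeq n^2$.
   Context: For an alphabet $A$, $A^*$ is the set of all finite words (including the empty word), and $|u|$ is the length of $u$. For a set $\mathcal{R}$ of rules $\ell\to r$ with $\ell,r\in A^*$, write $u\to_{\mathcal R}v$ if $u=\alpha \ell\beta$ and $v=\alpha r\beta$ for some rule $\ell\to r$ in $\mathcal{R}$ and some $\alpha,\beta\in A^*$. Derivational complexity of a semi-Thue system $(A,\mathcal{R})$: for a word $U$, $\delta_{(A,\mathcal R)}(U)$ is the maximal $m$ (possibly $\infty$) such that there exists a sequence $U=U_0\to_{\mathcal R}U_1\to_{\mathcal R}\dots\to_{\mathcal R}U_m$, and $\Delta_{(A,\mathcal R)}(n)=\max\{\delta_{(A,\mathcal R)}(U)\mid |U|=n\}$. Dehn function: let $\leftrightarrow^*_{\mathcal R}$ be the reflexive, symmetric and transitive closure of $\to_{\mathcal R}$; $\langle\langle A\mid\mathcal{R}\rangle\rangle$ is the set of its equivalence classes with the operation induced by concatenation. For $u\leftrightarrow^*_{\mathcal R}v$, $d_{\mathcal R}(u,v)$ is the minimal number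 of applications of rules of $\mathcal{R}$, each in either direction, needed to obtain $v$ from $u$. Then $D_E(n)=\max\{d_{\mathcal R}(u,v)\mid u,v\in A^*,\ u\leftrightarrow^*_{\mathcal R}v,\ |u|+|v|\le n\}$. $f\in\Theta(g)$ means that there are constants $C_1,C_2>0$ with $C_1g(n)\le f(n)\le C_2g(n)$ for all sufficiently large $n$. For non-decreasing functions $f,g$ on the positive integers with non-negative real values, $g\succeq f$ (equivalently $f\preceq g$) means there is a constant $c>0$ such that for every $n$ greater than some $N$ one has $f(n)\le c\,g(cn)+cn+c$ (here $c$ may be taken to be a positive integer, so that $cn$ is a positive integer). *)

theory Defs
  imports Complex_Main "HOL-Library.Extended_Nat" "HOL-Library.Landau_Symbols"
begin

text \<open>A semi-Thue system over the alphabet given by a type is its set of rules, a pair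
  \<open>(l, r)\<close> standing for \<open>l \<rightarrow> r\<close>.\<close>

type_synonym 'a rules = "('a list \<times> 'a list) set"

definition rewrite_step :: "'a rules \<Rightarrow> 'a list \<Rightarrow> 'a list \<Rightarrow> bool" where
  "rewrite_step \<R> u v \<longleftrightarrow>
     (\<exists>\<alpha> \<beta> l r. (l, r) \<in> \<R> \<and> u = \<alpha> @ l @ \<beta> \<and> v = \<alpha> @ r @ \<beta>)"

text \<open>The supremum in \<^typ>\<open>enat\<close> is the maximum if one exists, and \<open>\<infinity>\<close> if there are
  arbitrarily long derivations from the given word.\<close>

definition derivation_length :: "'a rules \<Rightarrow> 'a list \<Rightarrow> enat" where
  "derivation_length \<R> u = (SUP m\<in>{m. \<exists>v. (rewrite_step \<R> ^^ m) u v}. enat m)"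

definition derivational_complexity :: "'a rules \<Rightarrow> nat \<Rightarrow> enat" where
  "derivational_complexity \<R> n = (SUP u\<in>{u. length u = n}. derivation_length \<R> u)"

definition thue_equiv :: "'a rules \<Rightarrow> 'a list \<Rightarrow> 'a list \<Rightarrow> bool" where
  "thue_equiv \<R> = equivclp (rewrite_step \<R>)"

text \<open>Meaningful only for \<^prop>\<open>thue_equiv \<R> u v\<close>.\<close>

definition thue_dist :: "'a rules \<Rightarrow> 'a list \<Rightarrow> 'a list \<Rightarrow> nat" where
  "thue_dist \<R> u v = (LEAST m. (symclp (rewrite_step \<R>) ^^ m) u v)"

text \<open>The alphabet is required to be finite so that the maximum is over a finite set.\<close>

definition dehn_function :: "'a::finite rules \<Rightarrow> nat \<Rightarrow> nat" where
  "dehn_function \<R> n =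
     Max {thue_dist \<R> u v |u v. thue_equiv \<R> u v \<and> length u + length v \<le> n}"

text \<open>Functions on the positive integers are represented by functions on \<^typ>\<open>nat\<close>; their value
  at \<open>0\<close> is irrelevant, since \<open>n\<close> and \<open>c * n\<close> below are positive.\<close>

definition asymp_dominates :: "(nat \<Rightarrow> real) \<Rightarrow> (nat \<Rightarrow> real) \<Rightarrow> bool" (infix "\<succeq>" 50) where
  "g \<succeq> f \<longleftrightarrow>
     (\<exists>c::nat. c > 0 \<and> (\<exists>N. \<forall>n>N. f n \<le> real c * g (c * n) + real c * real n + real c))"

text \<open>\<open>Zero\<close> and \<open>ZeroBar\<close> are the letters written \<open>0\<close> and \<open>0\<close> with a bar.\<close>

datatype letter = Zero | ZeroBar | L | R | W

instance letter :: finite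
proof
  have "(UNIV :: letter set) = {Zero, ZeroBar, L, R, W}"
    using letter.exhaust by blast
  then show "finite (UNIV :: letter set)"
    by (metis finite.emptyI finite.insertI)
qed

definition E0 :: "letter rules" where
  "E0 = {([R, Zero], [ZeroBar, R]), ([ZeroBar, L], [L, Zero]),
         ([W, L], [W, R]), ([L, W, W], [R, Zero, W])}"

lemma finite_words_length_le: "finite {u :: 'a::finite list. length u \<le> n}"
  using finite_lists_length_le[of "UNIV :: 'a set" n] by simp

lemma finite_dehn_set:
  fixes \<R> :: "'a::finite rules"
  shows "finite {thue_dist \<R> u v |u v. thue_equiv \<R> u v \<and> length u + length v \<le> n}"
proof -
  have "{thue_dist \<R> u v |u v. thue_equiv \<R> u v \<and> length u + length v \<le> n}
      \<subseteq> (\<lambda>(u, v). thue_dist \<R> u v) ` ({u. length u \<le> n} \<times> {v. length v \<le> n})"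
    by auto
  then show ?thesis
    by (rule finite_subset) (intro finite_imageI finite_cartesian_product finite_words_length_le)
qed

end

theory Submission imports Defs begin

text \<open>
  Call \<open>L\<close> and \<open>R\<close> heads. Heads never cross each other, and a rule can turn an \<open>L\<close> into an \<open>R\<close>
  but not conversely.

  Forward derivations are short because each digit is crossed at most twice. A head \<open>R\<close> that crosses
  a \<open>0\<close> leaves behind a digit \<open>0\<close>-bar, which can be crossed again only by an \<open>L\<close> coming from the
  right; but the next head on its right is this \<open>R\<close>, and it stays an \<open>R\<close>. So a digit
  is crossed at most once by an \<open>L\<close> and then at most once by an \<open>R\<close>. New digits are paid for by the heads
  \<open>L\<close> that are used up. The function \<open>weight\<close> turns this into a linear bound
  (\<open>derivation_bounded_by_weight\<close>, \<open>weight_le\<close>), and the words \<open>R 0 ... 0\<close> show that its order is right.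

  Using the rules in both directions, the head can zigzag. On the words
  \<open>W 0bar^i h 0^j W^m\<close> with a single head \<open>h\<close>, one round trip across the tape of digits lets the
  head replace the last digit by \<open>W\<close>, so that \<open>W R 0^k W\<close> is equivalent to
  \<open>W R W^(k+1)\<close> (\<open>config_equiv_empty_tape\<close>). Those of a given length form a graph that is a path
  with some leaves attached, so there is no shortcut: the function \<open>potential\<close> is a position along
  this path, changes by at most 1 in each step (\<open>config_step\<close>), and differs by \<open>k * (k + 1)\<close>
  between the two words, whose lengths are both \<open>k + 3\<close>.\<close>

section \<open>Linear derivational complexity\<close>

fun next_head_is_L :: "letter list \<Rightarrow> bool" where
  "next_head_is_L [] = False"
| "next_head_is_L (x # xs) = (x = L \<or> x \<noteq> R \<and> next_head_is_L xs)"

text \<open>A bound on the number of crossings still ahead of each digit, plus 2 for each \<open>L\<close>: one for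
  its own turning into \<open>R\<close> and one for the digit it may then create.\<close>

fun weight :: "letter list \<Rightarrow> nat" where
  "weight [] = 0"
| "weight (x # xs) =
     (case x of Zero \<Rightarrow> 1 | ZeroBar \<Rightarrow> if next_head_is_L xs then 2 else 0 | L \<Rightarrow> 2 | _ \<Rightarrow> 0) + weight xs"

lemma weight_le: "weight u \<le> 2 * length u"
  by (induction u) (auto split: letter.split)

text \<open>The first conclusion is what the induction over the left context needs: a rule may change
  the next head from \<open>L\<close> to \<open>R\<close>, never the other way, so no digit on the left becomes heavier.\<close>

lemma rule_in_context_decreases_weight:
  assumes "(l, r) \<in> E0"
  shows "(next_head_is_L (\<alpha> @ r @ \<beta>) \<longrightarrow> next_head_is_L (\<alpha> @ l @ \<beta>)) \<and>
    weight (\<alpha> @ r @ \<beta>) < weight (\<alpha> @ l @ \<beta>)"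
  using assms
  by (induction \<alpha>) (auto simp: E0_def split: letter.split)

lemma derivation_bounded_by_weight: "(rewrite_step E0 ^^ m) u v \<Longrightarrow> weight v + m \<le> weight u"
proof (induction m arbitrary: v)
  case (Suc m)
  then obtain w where w: "(rewrite_step E0 ^^ m) u w" "rewrite_step E0 w v"
    by auto
  from w(2) have "weight v < weight w"
    unfolding rewrite_step_def using rule_in_context_decreases_weight by blast
  with Suc.IH[OF w(1)] show ?case
    by simp
qed auto

lemma derivational_complexity_le: "derivational_complexity E0 n \<le> enat (2 * n)"
  unfolding derivational_complexity_def derivation_length_def
proof (intro SUP_least)
  fix u m
  assume "u \<in> {u :: letter list. length u = n}" "m \<in> {m. \<exists>v. (rewrite_step E0 ^^ m) u v}"
  then show "enat m \<le> enat (2 * n)"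
    using derivation_bounded_by_weight[of m u] weight_le[of u] by fastforce
qed

lemma R_crosses_zeros:
  "(rewrite_step E0 ^^ m) (R # replicate m Zero) (replicate m ZeroBar @ [R])"
proof -
  have "(rewrite_step E0 ^^ i) (R # replicate (i + j) Zero)
      (replicate i ZeroBar @ R # replicate j Zero)" for i j
  proof (induction i arbitrary: j)
    case (Suc i)
    have "rewrite_step E0 (replicate i ZeroBar @ R # replicate (Suc j) Zero)
        (replicate (Suc i) ZeroBar @ R # replicate j Zero)"
      unfolding rewrite_step_def E0_def
      by (intro exI[of _ "replicate i ZeroBar"] exI[of _ "replicate j Zero"]
          exI[of _ "[R, Zero]"] exI[of _ "[ZeroBar, R]"])
        (simp add: replicate_append_same)
    with Suc.IH[of "Suc j"] show ?case
      by auto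
  qed auto
  from this[of m 0] show ?thesis
    by simp
qed

lemma derivational_complexity_ge: "enat n \<le> derivational_complexity E0 (Suc n)"
proof -
  have "enat n \<le> derivation_length E0 (R # replicate n Zero)"
    unfolding derivation_length_def using R_crosses_zeros by (intro SUP_upper) blast
  also have "\<dots> \<le> derivational_complexity E0 (Suc n)"
    unfolding derivational_complexity_def by (intro SUP_upper) simp
  finally show ?thesis .
qed

lemma derivational_complexity_finite: "derivational_complexity E0 n < \<infinity>"
  using derivational_complexity_le[of n] by (metis enat_ord_simps(4) le_less_trans enat.distinct(1))

lemma derivational_complexity_bigtheta:
  "(\<lambda>n. real (the_enat (derivational_complexity E0 n))) \<in> \<Theta>(\<lambda>n. real n)"
proof (rule bigthetaI)
  have upper: "the_enat (derivational_complexity E0 n) \<le> 2 * n" for n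
    using derivational_complexity_le[of n] by (metis enat_ile enat_ord_simps(1) the_enat.simps)
  show "(\<lambda>n. real (the_enat (derivational_complexity E0 n))) \<in> O(\<lambda>n. real n)"
  proof (rule bigoI[of _ 2], intro always_eventually allI)
    fix n
    show "norm (real (the_enat (derivational_complexity E0 n))) \<le> 2 * norm (real n)"
      using upper[of n] by simp
  qed
  have lower: "n \<le> 2 * the_enat (derivational_complexity E0 n)" if "n \<ge> 2" for n
  proof -
    obtain d where d: "derivational_complexity E0 n = enat d"
      using derivational_complexity_finite[of n] by auto
    with derivational_complexity_ge[of "n - 1"] that show ?thesis
      by simp
  qed
  show "(\<lambda>n. real (the_enat (derivational_complexity E0 n))) \<in> \<Omega>(\<lambda>n. real n)"
  proof (rule landau_omega.bigI[of "1/2"])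
    show "\<forall>\<^sub>F n in sequentially. norm (real (the_enat (derivational_complexity E0 n)))
        \<ge> 1/2 * norm (real n)"
      using eventually_ge_at_top[of 2]
    proof eventually_elim
      case (elim n)
      from lower[OF this] show ?case
        by simp
    qed
  qed simp
qed

section \<open>Quadratic distances\<close>

definition config :: "letter \<Rightarrow> nat \<Rightarrow> nat \<Rightarrow> nat \<Rightarrow> letter list" where
  "config h i j m = W # replicate i ZeroBar @ h # replicate j Zero @ replicate m W"

definition configs :: "letter list set" where
  "configs = {config h i j m |h i j m. h = L \<or> h = R}"

text \<open>A position along the path, where \<open>t\<close> is the number of digits. The values are forced, up to
  an additive constant: they increase by 1 in each step while \<open>R\<close> crosses all but the last of \<open>t + 1\<close>
  digits, replaces the last one by \<open>W\<close> while turning into \<open>L\<close>, crosses the remaining \<open>t\<close> digits as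
  \<open>L\<close>, and turns back into \<open>R\<close>. The constant is chosen to give the value 0 when \<open>R\<close> is the head and
  there are no digits.\<close>

definition potential :: "letter list \<Rightarrow> int" where
  "potential u =
     (let i = int (count_list u ZeroBar); j = int (count_list u Zero); t = i + j
      in if R \<in> set u then i - t * (t + 1) else t + 1 + j - (t + 1) * (t + 2))"

lemma count_list_replicate_letter [simp]:
  "count_list (replicate n x) y = (if x = y then n else 0)"
  by (induction n) auto

lemma potential_config_R: "potential (config R i j m) = int i - int (i + j) * (int (i + j) + 1)"
  by (simp add: potential_def config_def Let_def)

lemma potential_config_L:
  "potential (config L i j m) =
     int (i + j) + 1 + int j - (int (i + j) + 1) * (int (i + j) + 2)"
  by (simp add: potential_def config_def Let_def)

lemma config_split_at_head:
  assumes "config h i j m = \<alpha> @ x # \<beta>" and h: "h = L \<or> h = R" and x: "x = L \<or> x = R"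
  shows "x = h \<and> \<alpha> = W # replicate i ZeroBar \<and> \<beta> = replicate j Zero @ replicate m W"
proof -
  have "x \<in> set (config h i j m)"
    using assms(1) by simp
  then have "x = h"
    using x by (auto simp: config_def)
  then have "(W # replicate i ZeroBar) @ h # (replicate j Zero @ replicate m W) = \<alpha> @ h # \<beta>"
    using assms(1) by (simp add: config_def)
  moreover have "h \<notin> set (W # replicate i ZeroBar)" "h \<notin> set (replicate j Zero @ replicate m W)"
    using h by auto
  ultimately show ?thesis
    using \<open>x = h\<close> append_Cons_eq_iff by metis
qed

lemma replicate_ZeroBar_snocE:
  assumes "W # replicate i ZeroBar = \<alpha> @ [x]"
  obtains "i = 0" "x = W" "\<alpha> = []"
  | i' where "i = Suc i'" "x = ZeroBar" "\<alpha> = W # replicate i' ZeroBar"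
proof (cases i)
  case (Suc i')
  then have "\<alpha> @ [x] = (W # replicate i' ZeroBar) @ [ZeroBar]"
    using assms by (simp add: replicate_append_same)
  with Suc show thesis
    using that(2) by (metis append1_eq_conv)
qed (use assms that in auto)

lemma tape_ConsE:
  assumes "replicate j Zero @ replicate m W = x # \<beta>"
  obtains j' where "j = Suc j'" "x = Zero" "\<beta> = replicate j' Zero @ replicate m W"
  | m' where "j = 0" "m = Suc m'" "x = W" "\<beta> = replicate m' W"
  using assms that by (cases j; cases m) auto

text \<open>A word with just one head determines the positions at which a rule applies, in either
  direction, since each side of each rule contains a head.\<close>

lemma config_step:
  assumes "u \<in> configs" "symclp (rewrite_step E0) u v"
  shows "v \<in> configs \<and> \<bar>potential u - potential v\<bar> \<le> 1"
proof -
  obtain h i j m where u: "u = config h i j m" and h: "h = L \<or> h = R"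
    using assms(1) by (auto simp: configs_def)
  have good: ?thesis
    if "v = config h' i' j' m'" "h' = L \<or> h' = R"
      "\<bar>potential (config h i j m) - potential (config h' i' j' m')\<bar> \<le> 1" for h' i' j' m'
    using that u h unfolding configs_def by blast
  note split = config_split_at_head[OF _ h]
  obtain \<alpha> \<beta> l r where lr: "(l, r) \<in> E0"
    "(u = \<alpha> @ l @ \<beta> \<and> v = \<alpha> @ r @ \<beta>) \<or> (v = \<alpha> @ l @ \<beta> \<and> u = \<alpha> @ r @ \<beta>)"
    using assms(2) unfolding symclp_def rewrite_step_def by blast
  then consider
      (1) "u = \<alpha> @ R # Zero # \<beta>" "v = \<alpha> @ ZeroBar # R # \<beta>"
    | (2) "u = (\<alpha> @ [ZeroBar]) @ R # \<beta>" "v = \<alpha> @ R # Zero # \<beta>"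
    | (3) "u = (\<alpha> @ [ZeroBar]) @ L # \<beta>" "v = \<alpha> @ L # Zero # \<beta>"
    | (4) "u = \<alpha> @ L # Zero # \<beta>" "v = \<alpha> @ ZeroBar # L # \<beta>"
    | (5) "u = (\<alpha> @ [W]) @ L # \<beta>" "v = \<alpha> @ W # R # \<beta>"
    | (6) "u = (\<alpha> @ [W]) @ R # \<beta>" "v = \<alpha> @ W # L # \<beta>"
    | (7) "u = \<alpha> @ L # W # W # \<beta>" "v = \<alpha> @ R # Zero # W # \<beta>"
    | (8) "u = \<alpha> @ R # Zero # W # \<beta>" "v = \<alpha> @ L # W # W # \<beta>"
    unfolding E0_def by (elim disjE insertE; simp)
  then show ?thesis
  proof cases
    case 1
    with split[of i j m \<alpha> R "Zero # \<beta>"] u have s: "h = R" "\<alpha> = W # replicate i ZeroBar"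
      "replicate j Zero @ replicate m W = Zero # \<beta>" by auto
    from s(3) obtain j' where t: "j = Suc j'" "\<beta> = replicate j' Zero @ replicate m W"
      by (rule tape_ConsE) auto
    have "v = config R (Suc i) j' m"
      using 1 s t by (simp add: config_def replicate_app_Cons_same)
    then show ?thesis
      by (rule good) (use s(1) t in \<open>simp_all add: potential_config_R algebra_simps\<close>)
  next
    case 2
    with split[of i j m "\<alpha> @ [ZeroBar]" R \<beta>] u have s: "h = R" "W # replicate i ZeroBar = \<alpha> @ [ZeroBar]"
      "\<beta> = replicate j Zero @ replicate m W" by auto
    from s(2) obtain i' where t: "i = Suc i'" "\<alpha> = W # replicate i' ZeroBar"
      by (rule replicate_ZeroBar_snocE) auto
    have "v = config R i' (Suc j) m"
      using 2 s t by (simp add: config_def replicate_app_Cons_same)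
    then show ?thesis
      by (rule good) (use s(1) t in \<open>simp_all add: potential_config_R algebra_simps\<close>)
  next
    case 3
    with split[of i j m "\<alpha> @ [ZeroBar]" L \<beta>] u have s: "h = L" "W # replicate i ZeroBar = \<alpha> @ [ZeroBar]"
      "\<beta> = replicate j Zero @ replicate m W" by auto
    from s(2) obtain i' where t: "i = Suc i'" "\<alpha> = W # replicate i' ZeroBar"
      by (rule replicate_ZeroBar_snocE) auto
    have "v = config L i' (Suc j) m"
      using 3 s t by (simp add: config_def replicate_app_Cons_same)
    then show ?thesis
      by (rule good) (use s(1) t in \<open>simp_all add: potential_config_L algebra_simps\<close>)
  next
    case 4
    with split[of i j m \<alpha> L "Zero # \<beta>"] u have s: "h = L" "\<alpha> = W # replicate i ZeroBar"
      "replicate j Zero @ replicate m W = Zero # \<beta>" by auto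
    from s(3) obtain j' where t: "j = Suc j'" "\<beta> = replicate j' Zero @ replicate m W"
      by (rule tape_ConsE) auto
    have "v = config L (Suc i) j' m"
      using 4 s t by (simp add: config_def replicate_app_Cons_same)
    then show ?thesis
      by (rule good) (use s(1) t in \<open>simp_all add: potential_config_L algebra_simps\<close>)
  next
    case 5
    with split[of i j m "\<alpha> @ [W]" L \<beta>] u have s: "h = L" "W # replicate i ZeroBar = \<alpha> @ [W]"
      "\<beta> = replicate j Zero @ replicate m W" by auto
    from s(2) have t: "i = 0" "\<alpha> = []"
      by (auto elim: replicate_ZeroBar_snocE)
    have "v = config R 0 j m"
      using 5 s t by (simp add: config_def replicate_app_Cons_same)
    then show ?thesis
      by (rule good) (use s(1) t in \<open>simp_all add: potential_config_L potential_config_R algebra_simps\<close>)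
  next
    case 6
    with split[of i j m "\<alpha> @ [W]" R \<beta>] u have s: "h = R" "W # replicate i ZeroBar = \<alpha> @ [W]"
      "\<beta> = replicate j Zero @ replicate m W" by auto
    from s(2) have t: "i = 0" "\<alpha> = []"
      by (auto elim: replicate_ZeroBar_snocE)
    have "v = config L 0 j m"
      using 6 s t by (simp add: config_def replicate_app_Cons_same)
    then show ?thesis
      by (rule good) (use s(1) t in \<open>simp_all add: potential_config_L potential_config_R algebra_simps\<close>)
  next
    case 7
    with split[of i j m \<alpha> L "W # W # \<beta>"] u have s: "h = L" "\<alpha> = W # replicate i ZeroBar"
      "replicate j Zero @ replicate m W = W # W # \<beta>" by auto
    from s(3) obtain m' where t: "j = 0" "m = Suc m'" "W # \<beta> = replicate m' W"
      by (rule tape_ConsE) auto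
    have "v = config R i 1 m'"
      using 7 s t by (simp add: config_def replicate_app_Cons_same)
    then show ?thesis
      by (rule good) (use s(1) t in \<open>simp_all add: potential_config_L potential_config_R algebra_simps\<close>)
  next
    case 8
    with split[of i j m \<alpha> R "Zero # W # \<beta>"] u have s: "h = R" "\<alpha> = W # replicate i ZeroBar"
      "replicate j Zero @ replicate m W = Zero # W # \<beta>" by auto
    from s(3) obtain j' where j': "j = Suc j'" "replicate j' Zero @ replicate m W = W # \<beta>"
      by (metis letter.distinct(7) tape_ConsE)
    from j'(2) obtain m' where t: "j' = 0" "m = Suc m'" "\<beta> = replicate m' W"
      by (rule tape_ConsE) auto
    have "v = config L i 0 (Suc m)"
      using 8 s t j' by (simp add: config_def replicate_app_Cons_same)
    then show ?thesis
      by (rule good) (use s(1) t j'(1) in \<open>simp_all add: potential_config_L potential_config_R algebra_simps\<close>)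
  qed
qed

lemma potential_diff_le_path_length:
  assumes "u \<in> configs" "(symclp (rewrite_step E0) ^^ n) u v"
  shows "v \<in> configs \<and> \<bar>potential u - potential v\<bar> \<le> int n"
  using assms(2)
proof (induction n arbitrary: v)
  case (Suc n)
  then obtain w where w: "(symclp (rewrite_step E0) ^^ n) u w" "symclp (rewrite_step E0) w v"
    by auto
  with Suc.IH[OF w(1)] config_step[OF _ w(2)] show ?case
    by fastforce
qed (use assms(1) in auto)

lemma rule_imp_thue_equiv:
  assumes "(l, r) \<in> \<R>" "u = \<alpha> @ l @ \<beta>" "v = \<alpha> @ r @ \<beta>"
  shows "thue_equiv \<R> u v"
  unfolding thue_equiv_def rewrite_step_def using assms by (intro r_into_equivclp) blast

lemma thue_equiv_trans: "thue_equiv \<R> u v \<Longrightarrow> thue_equiv \<R> v w \<Longrightarrow> thue_equiv \<R> u w"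
  unfolding thue_equiv_def by (rule equivclp_trans)

lemma thue_equiv_sym: "thue_equiv \<R> u v \<Longrightarrow> thue_equiv \<R> v u"
  unfolding thue_equiv_def by (rule equivclp_sym)

lemma config_R_crosses: "thue_equiv E0 (config R i (n + j) m) (config R (i + n) j m)"
proof (induction n arbitrary: i)
  case 0
  then show ?case
    by (simp add: thue_equiv_def)
next
  case (Suc n)
  have "thue_equiv E0 (config R i (Suc n + j) m) (config R (Suc i) (n + j) m)"
    by (rule rule_imp_thue_equiv[of "[R, Zero]" "[ZeroBar, R]" _ _ "W # replicate i ZeroBar"
          "replicate (n + j) Zero @ replicate m W"])
      (auto simp: E0_def config_def replicate_app_Cons_same)
  from thue_equiv_trans[OF this Suc.IH[of "Suc i"]] show ?case
    by simp
qed

lemma config_L_crosses: "thue_equiv E0 (config L n j m) (config L 0 (n + j) m)"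
proof (induction n arbitrary: j)
  case 0
  then show ?case
    by (simp add: thue_equiv_def)
next
  case (Suc n)
  have "thue_equiv E0 (config L (Suc n) j m) (config L n (Suc j) m)"
    by (rule rule_imp_thue_equiv[of "[ZeroBar, L]" "[L, Zero]" _ _ "W # replicate n ZeroBar"
          "replicate j Zero @ replicate m W"])
      (auto simp: E0_def config_def replicate_app_Cons_same)
  from thue_equiv_trans[OF this Suc.IH[of "Suc j"]] show ?case
    by simp
qed

text \<open>The zigzag: the head moves right up to the last digit, erases it by the reverse of
  \<open>LWW \<rightarrow> R0W\<close>, and returns.\<close>

lemma config_equiv_shorter_tape:
  "thue_equiv E0 (config R 0 (Suc k) (Suc m)) (config R 0 k (Suc (Suc m)))"
proof -
  have "thue_equiv E0 (config R 0 (Suc k) (Suc m)) (config R k 1 (Suc m))"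
    using config_R_crosses[of 0 k 1] by simp
  moreover have "thue_equiv E0 (config L k 0 (Suc (Suc m))) (config R k 1 (Suc m))"
    by (rule rule_imp_thue_equiv[of "[L, W, W]" "[R, Zero, W]" _ _ "W # replicate k ZeroBar"
          "replicate m W"])
      (auto simp: E0_def config_def)
  moreover have "thue_equiv E0 (config L k 0 (Suc (Suc m))) (config L 0 k (Suc (Suc m)))"
    using config_L_crosses[of k 0] by simp
  moreover have "thue_equiv E0 (config L 0 k (Suc (Suc m))) (config R 0 k (Suc (Suc m)))"
    by (rule rule_imp_thue_equiv[of "[W, L]" "[W, R]" _ _ "[]"
          "replicate k Zero @ replicate (Suc (Suc m)) W"])
      (auto simp: E0_def config_def)
  ultimately show ?thesis
    using thue_equiv_trans thue_equiv_sym by meson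
qed

lemma config_equiv_empty_tape:
  "thue_equiv E0 (config R 0 k (Suc m)) (config R 0 0 (Suc (k + m)))"
proof (induction k arbitrary: m)
  case 0
  then show ?case
    by (simp add: thue_equiv_def)
next
  case (Suc k)
  from thue_equiv_trans[OF config_equiv_shorter_tape Suc.IH[of "Suc m"]] show ?case
    by simp
qed

lemma ex_thue_path:
  assumes "thue_equiv \<R> u v"
  shows "(symclp (rewrite_step \<R>) ^^ thue_dist \<R> u v) u v"
proof -
  from assms have "\<exists>n. (symclp (rewrite_step \<R>) ^^ n) u v"
    unfolding thue_equiv_def equivclp_def by (simp add: rtranclp_imp_relpowp)
  then show ?thesis
    unfolding thue_dist_def by (rule LeastI_ex)
qed

lemma thue_dist_le_dehn_function:
  "thue_equiv \<R> u v \<Longrightarrow> length u + length v \<le> n \<Longrightarrow> thue_dist \<R> u v \<le> dehn_function \<R> n"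
  unfolding dehn_function_def by (intro Max_ge finite_dehn_set) blast

lemma dehn_function_ge:
  assumes "2 * k + 6 \<le> n"
  shows "k * (k + 1) \<le> dehn_function E0 n"
proof -
  define u v where "u = config R 0 k 1" and "v = config R 0 0 (Suc k)"
  have equiv: "thue_equiv E0 u v"
    using config_equiv_empty_tape[of k 0] by (simp add: u_def v_def)
  have "u \<in> configs"
    by (auto simp: configs_def u_def)
  from potential_diff_le_path_length[OF this ex_thue_path[OF equiv]]
  have "\<bar>potential u - potential v\<bar> \<le> int (thue_dist E0 u v)"
    by blast
  moreover have "potential u = - int (k * (k + 1))" "potential v = 0"
    by (simp_all add: u_def v_def potential_config_R algebra_simps)
  ultimately have "int (k * (k + 1)) \<le> int (thue_dist E0 u v)"
    by linarith
  also have "thue_dist E0 u v \<le> dehn_function E0 n"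
    using assms by (intro thue_dist_le_dehn_function equiv) (simp add: u_def v_def config_def)
  finally show ?thesis
    by (simp only: of_nat_le_iff)
qed

lemma dehn_function_dominates_square: "(\<lambda>n. real (dehn_function E0 n)) \<succeq> (\<lambda>n. real n ^ 2)"
proof -
  \<comment> \<open>The factor 8 makes \<open>2 * n + 6 \<le> 8 * n\<close> for all \<open>n > 0\<close>.\<close>
  have "real n ^ 2 \<le> real 8 * real (dehn_function E0 (8 * n)) + real 8 * real n + real 8"
    if "n > 0" for n
  proof -
    have "n ^ 2 \<le> dehn_function E0 (8 * n)"
      using dehn_function_ge[of n "8 * n"] that by (simp add: power2_eq_square)
    then have "real (n ^ 2) \<le> real (dehn_function E0 (8 * n))"
      by (simp only: of_nat_le_iff)
    then show ?thesis
      unfolding of_nat_power by linarith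
  qed
  then show ?thesis
    unfolding asymp_dominates_def by (intro exI[of _ 8]) auto
qed

theorem mainTheorem2:
  shows "((\<forall>\<^sub>F n in sequentially. derivational_complexity E0 n < \<infinity>) \<and>
          (\<lambda>n. real (the_enat (derivational_complexity E0 n))) \<in> \<Theta>(\<lambda>n. real n)) \<and>
         (\<lambda>n. real (dehn_function E0 n)) \<succeq> (\<lambda>n. real n ^ 2)"
  using derivational_complexity_finite derivational_complexity_bigtheta
    dehn_function_dominates_square
  by simp

end
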